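(* Polytree Learning with additive scores and in-degree bound $k$ (PT$_{\le}^{+}$) admits a polynomial-time $2$-approximation algorithm: an algorithm running in polynomial time that outputs a polytree $D$ with every in-degree at most $k$ such that $f(D)\le f(D^{\mathrm{opt}})\le 2 f(D)$, where $D^{\mathrm{opt}}$ is a maximum-score polytree with every in-degree at most $k$.
   Context: A DAG $D=(V,A)$ is a polytree if its skeleton is a forest; $D_v$ is the parent set of $v$. In PT$_{\le}^{+}$ the input consists of a node set $V$, an integer $k$, and real values $f_v(\{u\})$ for all distinct $u,v\in V$; the local scores are additive: $f_v(S)=\sum_{u\in S} f_v(\{u\})$ (so $f_v(\emptyset)=0$). The score of $D$ is $f(D)=\sum_v f_v(D_v)$. Feasible solutions are polytrees on $V$ in which every node has at most $k$ parents; the goal is a feasible polytree of maximum score. *)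

theory Defs
  imports Complex_Main "HOL-Computational_Algebra.Polynomial"
begin

section \<open>Polytrees\<close>

definition dag :: "'a set \<Rightarrow> ('a \<times> 'a) set \<Rightarrow> bool" where
  "dag V A \<longleftrightarrow> A \<subseteq> V \<times> V \<and> acyclic A"

definition skeleton :: "('a \<times> 'a) set \<Rightarrow> 'a set set" where
  "skeleton A = {{u, v} | u v. (u, v) \<in> A}"

definition undirected_cycle :: "'a set set \<Rightarrow> 'a list \<Rightarrow> bool" where
  "undirected_cycle E xs \<longleftrightarrow> length xs \<ge> 3 \<and> distinct xs \<and>
     (\<forall>i < length xs. {xs ! i, xs ! (Suc i mod length xs)} \<in> E)"

definition forest :: "'a set set \<Rightarrow> bool" where
  "forest E \<longleftrightarrow> (\<nexists>xs. undirected_cycle E xs)"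

definition polytree :: "'a set \<Rightarrow> ('a \<times> 'a) set \<Rightarrow> bool" where
  "polytree V A \<longleftrightarrow> dag V A \<and> forest (skeleton A)"

definition parents :: "('a \<times> 'a) set \<Rightarrow> 'a \<Rightarrow> 'a set" where
  "parents A v = {u. (u, v) \<in> A}"


section \<open>Polytree learning with additive scores and bounded in-degree\<close>

definition additive_scores :: "'a set \<Rightarrow> ('a \<Rightarrow> 'a set \<Rightarrow> real) \<Rightarrow> bool" where
  "additive_scores V f \<longleftrightarrow>
     (\<forall>v \<in> V. \<forall>S \<subseteq> V - {v}. f v S = (\<Sum>u \<in> S. f v {u}))"

definition score :: "'a set \<Rightarrow> ('a \<Rightarrow> 'a set \<Rightarrow> real) \<Rightarrow> ('a \<times> 'a) set \<Rightarrow> real" where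
  "score V f A = (\<Sum>v \<in> V. f v (parents A v))"

definition feasible :: "'a set \<Rightarrow> nat \<Rightarrow> ('a \<times> 'a) set \<Rightarrow> bool" where
  "feasible V k A \<longleftrightarrow> polytree V A \<and> (\<forall>v \<in> V. card (parents A v) \<le> k)"

definition optimal ::
    "'a set \<Rightarrow> nat \<Rightarrow> ('a \<Rightarrow> 'a set \<Rightarrow> real) \<Rightarrow> ('a \<times> 'a) set \<Rightarrow> bool" where
  "optimal V k f A \<longleftrightarrow> feasible V k A \<and> (\<forall>B. feasible V k B \<longrightarrow> score V f B \<le> score V f A)"

lemma feasible_empty: "feasible V k {}"
proof -
  have "\<not> undirected_cycle {} xs" for xs :: "'a list"
    unfolding undirected_cycle_def by (cases xs) auto
  then show ?thesis
    by (simp add: feasible_def polytree_def dag_def forest_def skeleton_def parents_def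
        acyclic_def)
qed

lemma ex_optimal:
  assumes "finite V"
  shows "\<exists>A. optimal V k f A"
proof -
  let ?F = "{A. feasible V k A}"
  have "?F \<subseteq> Pow (V \<times> V)"
    by (auto simp: feasible_def polytree_def dag_def)
  then have fin: "finite ?F"
    using assms by (meson finite_Pow_iff finite_SigmaI finite_subset)
  have "?F \<noteq> {}"
    using feasible_empty by blast
  then have "Max (score V f ` ?F) \<in> score V f ` ?F"
    using fin by (intro Max_in) auto
  then obtain A where A: "feasible V k A" "score V f A = Max (score V f ` ?F)"
    by auto
  have "score V f B \<le> score V f A" if "feasible V k B" for B
    unfolding A(2) using fin that by (intro Max_ge) auto
  then show ?thesis
    using A(1) by (auto simp: optimal_def)
qed


section \<open>Random access machine programs over natural and real numbers\<close>

text \<open>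
  Algorithms are programs of a fixed while language whose memory consists of named, unbounded
  arrays of natural numbers and of real numbers; the name of an array is part of the program text,
  the index is computed. The only arithmetic is addition and subtraction (truncated on the natural
  numbers), and the only real constants are 0 and 1. With multiplication, unit cost would be too
  generous, because repeated squaring produces numbers of exponential length. Without it, the
  length of every number grows by at most a constant per step, so that on rational inputs the step
  count is polynomially related to the running time of a Turing machine.

  Every assignment and every evaluation of a test costs one step. The expressions of a program have
  a fixed size, so counting their individual operations would change the running time by a constant
  factor only.
\<close>

type_synonym name = string

datatype nexp =
    NConst nat
  | NGet name nexp
  | NAdd nexp nexp
  | NSub nexp nexp

datatype rexp =
    RZero
  | ROne
  | RGet name nexp
  | RAdd rexp rexp
  | RSub rexp rexp

datatype test =
    NLess nexp nexp
  | RLess rexp rexp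
  | Neg test
  | Conj test test

datatype com =
    Skip
  | NSet name nexp nexp
  | RSet name nexp rexp
  | Seq com com
  | Cond test com com
  | While test com

record state =
  nats :: "name \<Rightarrow> nat \<Rightarrow> nat"
  reals :: "name \<Rightarrow> nat \<Rightarrow> real"

primrec nval :: "nexp \<Rightarrow> state \<Rightarrow> nat" where
  "nval (NConst m) s = m"
| "nval (NGet x e) s = nats s x (nval e s)"
| "nval (NAdd d e) s = nval d s + nval e s"
| "nval (NSub d e) s = nval d s - nval e s"

primrec rval :: "rexp \<Rightarrow> state \<Rightarrow> real" where
  "rval RZero s = 0"
| "rval ROne s = 1"
| "rval (RGet x e) s = reals s x (nval e s)"
| "rval (RAdd d e) s = rval d s + rval e s"
| "rval (RSub d e) s = rval d s - rval e s"

primrec tval :: "test \<Rightarrow> state \<Rightarrow> bool" where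
  "tval (NLess d e) s \<longleftrightarrow> nval d s < nval e s"
| "tval (RLess d e) s \<longleftrightarrow> rval d s < rval e s"
| "tval (Neg b) s \<longleftrightarrow> \<not> tval b s"
| "tval (Conj a b) s \<longleftrightarrow> tval a s \<and> tval b s"

definition nwrite :: "name \<Rightarrow> nat \<Rightarrow> nat \<Rightarrow> state \<Rightarrow> state" where
  "nwrite x i m s = s\<lparr>nats := (nats s)(x := (nats s x)(i := m))\<rparr>"

definition rwrite :: "name \<Rightarrow> nat \<Rightarrow> real \<Rightarrow> state \<Rightarrow> state" where
  "rwrite x i r s = s\<lparr>reals := (reals s)(x := (reals s x)(i := r))\<rparr>"

text \<open>
  \<open>exec c s t s'\<close>: started in state \<open>s\<close>, the program \<open>c\<close> halts after \<open>t\<close> steps in state \<open>s'\<close>.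
\<close>

inductive exec :: "com \<Rightarrow> state \<Rightarrow> nat \<Rightarrow> state \<Rightarrow> bool" where
  Skip: "exec Skip s 1 s"
| NSet: "exec (NSet x d e) s 1 (nwrite x (nval d s) (nval e s) s)"
| RSet: "exec (RSet x d e) s 1 (rwrite x (nval d s) (rval e s) s)"
| Seq: "exec c s t s' \<Longrightarrow> exec d s' t' s'' \<Longrightarrow> exec (Seq c d) s (t + t') s''"
| CondTrue: "tval b s \<Longrightarrow> exec c s t s' \<Longrightarrow> exec (Cond b c d) s (1 + t) s'"
| CondFalse: "\<not> tval b s \<Longrightarrow> exec d s t s' \<Longrightarrow> exec (Cond b c d) s (1 + t) s'"
| WhileFalse: "\<not> tval b s \<Longrightarrow> exec (While b c) s 1 s"
| WhileTrue: "tval b s \<Longrightarrow> exec c s t s' \<Longrightarrow> exec (While b c) s' t' s'' \<Longrightarrow>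
    exec (While b c) s (1 + t + t') s''"

inductive_cases exec_SkipE: "exec Skip s t s'"
inductive_cases exec_NSetE: "exec (NSet x d e) s t s'"
inductive_cases exec_RSetE: "exec (RSet x d e) s t s'"
inductive_cases exec_SeqE: "exec (Seq c d) s t s'"
inductive_cases exec_CondE: "exec (Cond b c d) s t s'"
inductive_cases exec_WhileE: "exec (While b c) s t s'"

lemma exec_deterministic:
  "exec c s t s' \<Longrightarrow> exec c s u s'' \<Longrightarrow> u = t \<and> s'' = s'"
proof (induction arbitrary: u s'' rule: exec.induct)
  case (Skip s)
  then show ?case by (rule exec_SkipE) simp
next
  case (NSet x d e s)
  then show ?case by (rule exec_NSetE) simp
next
  case (RSet x d e s)
  then show ?case by (rule exec_RSetE) simp
next
  case (Seq c s t s1 d t' s2)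
  from Seq.prems obtain v s3 v' where "exec c s v s3" "exec d s3 v' s''" "u = v + v'"
    by (rule exec_SeqE)
  with Seq.IH(1)[of v s3] Seq.IH(2)[of v' s''] show ?case by simp
next
  case (CondTrue b s c t s' d)
  from CondTrue.prems obtain v where "exec c s v s''" "u = 1 + v"
    by (rule exec_CondE) (use CondTrue.hyps(1) in simp_all)
  with CondTrue.IH[of v s''] show ?case by simp
next
  case (CondFalse b s d t s' c)
  from CondFalse.prems obtain v where "exec d s v s''" "u = 1 + v"
    by (rule exec_CondE) (use CondFalse.hyps(1) in simp_all)
  with CondFalse.IH[of v s''] show ?case by simp
next
  case (WhileFalse b s c)
  from WhileFalse.prems show ?case
    by (rule exec_WhileE) (use WhileFalse.hyps in simp_all)
next
  case (WhileTrue b s c t s1 t' s2)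
  from WhileTrue.prems obtain v s3 v'
    where "exec c s v s3" "exec (While b c) s3 v' s''" "u = 1 + v + v'"
    by (rule exec_WhileE) (use WhileTrue.hyps(1) in simp_all)
  with WhileTrue.IH(1)[of v s3] WhileTrue.IH(2)[of v' s''] show ?case by simp
qed


section \<open>Encoding of inputs and outputs\<close>

text \<open>
  The node set is \<open>{..<n}\<close>. Initially the scalars \<open>n\<close> and \<open>k\<close> are stored at index 0 of the arrays of
  these names, and the real array \<open>f\<close> holds the value of \<open>f v {u}\<close> at index \<open>v * n + u\<close>, for all
  distinct nodes \<open>u\<close> and \<open>v\<close>. All other memory cells are 0.
\<close>

definition input_state :: "nat \<Rightarrow> nat \<Rightarrow> (nat \<Rightarrow> nat set \<Rightarrow> real) \<Rightarrow> state" where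
  "input_state n k f = \<lparr>
     nats = (\<lambda>x i. if x = ''n'' \<and> i = 0 then n else if x = ''k'' \<and> i = 0 then k else 0),
     reals = (\<lambda>x i. if x = ''f'' \<and> i < n * n \<and> i div n \<noteq> i mod n
                    then f (i div n) {i mod n} else 0)\<rparr>"

lemma input_state_score:
  assumes "u < n" "v < n" "u \<noteq> v"
  shows "reals (input_state n k f) ''f'' (v * n + u) = f v {u}"
proof -
  have "v * n + u < Suc v * n"
    using assms(1) by simp
  also have "Suc v * n \<le> n * n"
    using assms(2) by (intro mult_le_mono1) simp
  finally show ?thesis
    using assms by (simp add: input_state_def)
qed

text \<open>
  The computed arc set is output as a list: its length is at index 0 of \<open>m\<close>, and the tail and the
  head of its entry \<open>i\<close> are at index \<open>i\<close> of \<open>tail\<close> and \<open>head\<close>.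
\<close>

definition output_arcs :: "state \<Rightarrow> (nat \<times> nat) set" where
  "output_arcs s = {(nats s ''tail'' i, nats s ''head'' i) | i. i < nats s ''m'' 0}"

end

theory Submission
  imports Defs
begin

text \<open>
  The algorithm is greedy: starting from the empty arc set, it repeatedly adds an arc of maximum
  positive weight that keeps the arc set \<open>G\<close> feasible. Feasible arc sets are the common independent
  sets of a graphic matroid (an arc set is a polytree iff each of its arcs is a bridge) and a
  partition matroid (the in-degree bound). Hence, if \<open>G \<union> R\<close> is feasible, then adding the greedy arc
  \<open>e\<close> to \<open>G\<close> costs at most two arcs of \<open>R\<close>, one per matroid. Each of them was itself a candidate and
  so weighs at most as much as \<open>e\<close>. Starting with an optimal \<open>R\<close>, this keeps the optimum below
  twice the weight of \<open>G\<close> plus the weight of \<open>R\<close>, and when no candidate of positive weight is left,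
  the weight of \<open>R\<close> is at most 0.
\<close>

section \<open>Polytrees as arc sets in which every arc is a bridge\<close>

definition joined :: "('a \<times> 'a) set \<Rightarrow> ('a \<times> 'a) set" where
  "joined A = (A \<union> A\<inverse>)\<^sup>*"

text \<open>Independence in the graphic matroid on arcs. Loops are excluded because
  \<open>joined\<close> is reflexive, and so are antiparallel arcs, although these share one edge of
  the skeleton.\<close>

definition bridged :: "('a \<times> 'a) set \<Rightarrow> bool" where
  "bridged A \<longleftrightarrow> (\<forall>(u, v) \<in> A. (u, v) \<notin> joined (A - {(u, v)}))"

lemma joined_refl [simp]: "(u, u) \<in> joined A"
  by (simp add: joined_def)

lemma joined_arc: "(u, v) \<in> A \<Longrightarrow> (u, v) \<in> joined A"
  by (auto simp: joined_def)

lemma joined_sym: "(u, v) \<in> joined A \<Longrightarrow> (v, u) \<in> joined A"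
  unfolding joined_def by (meson sym_Un_converse sym_rtrancl symD)

lemma joined_trans: "(u, v) \<in> joined A \<Longrightarrow> (v, w) \<in> joined A \<Longrightarrow> (u, w) \<in> joined A"
  unfolding joined_def by (rule rtrancl_trans)

lemma joined_mono: "A \<subseteq> B \<Longrightarrow> joined A \<subseteq> joined B"
  unfolding joined_def by (intro rtrancl_mono) auto

lemma joined_empty: "joined {} = Id"
  by (simp add: joined_def)

text \<open>A walk that crosses the new arc repeatedly can be shortened to cross it at most once;
  the last two disjuncts are the two directions.\<close>

lemma joined_insert:
  "(x, y) \<in> joined (insert (a, b) A) \<longleftrightarrow>
     (x, y) \<in> joined A \<or> (x, a) \<in> joined A \<and> (b, y) \<in> joined A \<or>
     (x, b) \<in> joined A \<and> (a, y) \<in> joined A" (is "?L \<longleftrightarrow> ?R y")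
proof
  assume ?L
  then have "(x, y) \<in> (insert (a, b) A \<union> (insert (a, b) A)\<inverse>)\<^sup>*"
    by (simp add: joined_def)
  then show "?R y"
  proof (induction rule: rtrancl_induct)
    case base
    then show ?case by simp
  next
    case (step y z)
    then consider "(y, z) \<in> joined A" | "y = a" "z = b" | "y = b" "z = a"
      by (auto simp: joined_def)
    then show ?case
      using step.IH by cases (blast intro: joined_trans joined_refl)+
  qed
next
  assume "?R y"
  moreover have "\<And>u v. (u, v) \<in> joined A \<Longrightarrow> (u, v) \<in> joined (insert (a, b) A)"
    using joined_mono[of A "insert (a, b) A"] by blast
  moreover have "(a, b) \<in> joined (insert (a, b) A)" "(b, a) \<in> joined (insert (a, b) A)"
    by (auto intro: joined_arc joined_sym)
  ultimately show ?L
    by (meson joined_trans)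
qed

text \<open>Supplies the repetition-free list that \<open>undirected_cycle\<close> asks for.\<close>

lemma joined_path:
  assumes "(u, v) \<in> joined A"
  shows "\<exists>xs. xs \<noteq> [] \<and> distinct xs \<and> hd xs = u \<and> last xs = v \<and>
    successively (\<lambda>x y. (x, y) \<in> A \<union> A\<inverse>) xs"
  using assms unfolding joined_def
proof (induction rule: rtrancl_induct)
  case base
  show ?case by (intro exI[of _ "[u]"]) simp
next
  case (step y z)
  then obtain xs where xs: "xs \<noteq> []" "distinct xs" "hd xs = u" "last xs = y"
    "successively (\<lambda>x y. (x, y) \<in> A \<union> A\<inverse>) xs"
    by blast
  show ?case
  proof (cases "z \<in> set xs")
    case True
    then obtain ys zs where "xs = ys @ z # zs"
      by (meson split_list)
    then show ?thesis
      using xs by (intro exI[of _ "ys @ [z]"])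
        (auto simp: successively_append_iff successively_Cons hd_append)
  next
    case False
    then show ?thesis
      using xs step.hyps by (intro exI[of _ "xs @ [z]"])
        (auto simp: successively_append_iff)
  qed
qed

section \<open>Hereditary and exchange properties of bridged arc sets\<close>

lemma bridged_subset: "bridged B \<Longrightarrow> A \<subseteq> B \<Longrightarrow> bridged A"
  unfolding bridged_def using joined_mono[OF Diff_mono[OF _ subset_refl], of A B] by blast

text \<open>A cycle through the new arc and an old arc \<open>(x, y)\<close> would, without the new
  arc, connect \<open>a\<close> and \<open>b\<close> inside \<open>A\<close>.\<close>

lemma bridged_insert:
  assumes "bridged A" "(a, b) \<notin> joined A"
  shows "bridged (insert (a, b) A)"
  unfolding bridged_def
proof (safe del: notI)
  have "joined (insert (a, b) A - {(a, b)}) \<subseteq> joined A"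
    by (intro joined_mono) auto
  then show "(a, b) \<notin> joined (insert (a, b) A - {(a, b)})"
    using assms(2) by blast
next
  fix x y assume xy: "(x, y) \<in> A"
  let ?C = "A - {(x, y)}"
  show "(x, y) \<notin> joined (insert (a, b) A - {(x, y)})"
  proof
    assume "(x, y) \<in> joined (insert (a, b) A - {(x, y)})"
    moreover have "joined (insert (a, b) A - {(x, y)}) \<subseteq> joined (insert (a, b) ?C)"
      by (intro joined_mono) auto
    ultimately have "(x, y) \<in> joined (insert (a, b) ?C)"
      by blast
    moreover have "(x, y) \<notin> joined ?C"
      using assms(1) xy by (auto simp: bridged_def)
    ultimately have "(x, a) \<in> joined ?C \<and> (b, y) \<in> joined ?C \<or>
        (x, b) \<in> joined ?C \<and> (a, y) \<in> joined ?C"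
      by (simp add: joined_insert)
    moreover have "\<And>u v. (u, v) \<in> joined ?C \<Longrightarrow> (u, v) \<in> joined A \<and> (v, u) \<in> joined A"
      using joined_sym[of _ _ A] subsetD[OF joined_mono[OF Diff_subset]] by meson
    moreover have "(x, y) \<in> joined A" "(y, x) \<in> joined A"
      using joined_arc[OF xy] joined_sym by auto
    ultimately have "(a, b) \<in> joined A"
      by (meson joined_trans)
    with assms(2) show False ..
  qed
qed

lemma bridged_insertD:
  assumes "bridged (insert (a, b) A)" "(a, b) \<notin> A"
  shows "(a, b) \<notin> joined A"
  using assms by (auto simp: bridged_def)

text \<open>Adding \<open>(a, b)\<close> to \<open>G \<union> R\<close> closes at most one cycle.
  Since \<open>G\<close> alone does not join \<open>a\<close> and \<open>b\<close>, that cycle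
  contains an arc of \<open>R\<close>, whose deletion restores independence.\<close>

lemma bridged_exchange:
  assumes "finite R" "bridged (G \<union> R)" "(a, b) \<notin> joined G"
  shows "\<exists>R' \<subseteq> R. card (R - R') \<le> 1 \<and> bridged (insert (a, b) (G \<union> R'))"
proof (cases "(a, b) \<in> joined (G \<union> R)")
  case False
  then show ?thesis
    using assms(2) by (intro exI[of _ R]) (simp add: bridged_insert)
next
  case True
  \<comment> \<open>Any arc of a minimal \<open>S \<subseteq> R\<close> that joins \<open>a\<close> and \<open>b\<close> together with \<open>G\<close> lies on the cycle
    closed by \<open>(a, b)\<close> in \<open>G \<union> R\<close>.\<close>
  let ?P = "\<lambda>S. S \<subseteq> R \<and> (a, b) \<in> joined (G \<union> S)"
  obtain S where S: "?P S" and min: "\<And>T. ?P T \<Longrightarrow> card S \<le> card T"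
    using True ex_has_least_nat[of ?P R card] by auto
  have "S \<noteq> {}"
    using S assms(3) by auto
  then obtain x y where xy: "(x, y) \<in> S"
    by (metis all_not_in_conv surj_pair)
  let ?S = "G \<union> (S - {(x, y)})" and ?R = "G \<union> (R - {(x, y)})"
  have "finite S"
    using S assms(1) finite_subset by blast
  then have "card (S - {(x, y)}) < card S"
    using xy by (rule card_Diff1_less)
  then have no: "(a, b) \<notin> joined ?S"
    using min[of "S - {(x, y)}"] S by fastforce
  have "insert (x, y) ?S = G \<union> S"
    using xy by auto
  then have "(a, b) \<in> joined (insert (x, y) ?S)"
    using S by simp
  with no have *: "(a, x) \<in> joined ?S \<and> (y, b) \<in> joined ?S \<or>
      (a, y) \<in> joined ?S \<and> (x, b) \<in> joined ?S"
    by (simp add: joined_insert)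
  have sub: "(u, v) \<in> joined ?R \<and> (v, u) \<in> joined ?R" if "(u, v) \<in> joined ?S" for u v
  proof -
    have "?S \<subseteq> ?R"
      using S by auto
    then show ?thesis
      using that joined_mono joined_sym by (meson subsetD)
  qed
  have "(x, y) \<notin> G"
  proof
    assume "(x, y) \<in> G"
    then have "?S = G \<union> S" by auto
    with no S show False by simp
  qed
  then have "G \<union> R - {(x, y)} = ?R"
    by auto
  moreover have "(x, y) \<notin> joined (G \<union> R - {(x, y)})"
    using assms(2) xy S unfolding bridged_def by blast
  ultimately have "(x, y) \<notin> joined ?R"
    by simp
  \<comment> \<open>By \<open>*\<close>, a connection of \<open>a\<close> and \<open>b\<close> in
    \<open>?R\<close> would also connect \<open>x\<close> and \<open>y\<close> there, but
    \<open>(x, y)\<close> is a bridge of \<open>G \<union> R\<close>.\<close>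
  with * sub have "(a, b) \<notin> joined ?R"
    by (meson joined_trans joined_sym)
  moreover have "bridged ?R"
    using assms(2) by (rule bridged_subset) auto
  ultimately have "bridged (insert (a, b) ?R)"
    by (rule bridged_insert[rotated])
  moreover have "card (R - (R - {(x, y)})) \<le> 1"
    using card_mono[of "{(x, y)}" "R - (R - {(x, y)})"] by auto
  ultimately show ?thesis
    by blast
qed

section \<open>Equivalence of polytrees and bridged arc sets\<close>

lemma rtrancl_avoid_arc:
  assumes "(v, w) \<in> A\<^sup>*"
  shows "(v, w) \<in> (A - {(u, v)})\<^sup>*"
  using assms
proof (induction rule: rtrancl_induct)
  case base
  show ?case by simp
next
  case (step y z)
  then show ?case
    by (cases "z = v") (auto intro: rtrancl_into_rtrancl)
qed

lemma bridged_imp_acyclic: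
  assumes "bridged A"
  shows "acyclic A"
  unfolding acyclic_def
proof safe
  fix u assume "(u, u) \<in> A\<^sup>+"
  then obtain v where v: "(u, v) \<in> A" "(v, u) \<in> A\<^sup>*"
    by (meson tranclD)
  have "(v, u) \<in> (A - {(u, v)})\<^sup>*"
    using v(2) by (rule rtrancl_avoid_arc)
  then have "(v, u) \<in> joined (A - {(u, v)})"
    unfolding joined_def using rtrancl_mono[of "A - {(u, v)}"] by blast
  with assms v(1) show False
    by (auto simp: bridged_def dest: joined_sym)
qed

lemma bridged_imp_forest:
  assumes "bridged A"
  shows "forest (skeleton A)"
  unfolding forest_def
proof
  assume "\<exists>xs. undirected_cycle (skeleton A) xs"
  then obtain xs where len: "length xs \<ge> 3" and dist: "distinct xs"
    and edge: "\<And>i. i < length xs \<Longrightarrow> {xs ! i, xs ! (Suc i mod length xs)} \<in> skeleton A"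
    by (auto simp: undirected_cycle_def)
  let ?l = "length xs - 1"
  have "{xs ! ?l, xs ! 0} \<in> skeleton A"
    using edge[of ?l] len by (cases xs) auto
  then obtain u v where uv: "(u, v) \<in> A" "{u, v} = {xs ! ?l, xs ! 0}"
    by (auto simp: skeleton_def)
  let ?B = "A - {(u, v)}"
  have "(xs ! 0, xs ! i) \<in> joined ?B" if "i \<le> ?l" for i
    using that
  proof (induction i)
    case 0
    show ?case by simp
  next
    case (Suc i)
    have "Suc i < length xs"
      using Suc.prems len by linarith
    then have "{xs ! i, xs ! Suc i} \<in> skeleton A"
      using edge[of i] by simp
    then obtain x y where xy: "(x, y) \<in> A" "{x, y} = {xs ! i, xs ! Suc i}"
      by (auto simp: skeleton_def)
    \<comment> \<open>This is where length at least 3 enters: with two nodes, the forward step and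
      the closing edge would have the same ends.\<close>
    have "{xs ! i, xs ! Suc i} \<noteq> {xs ! ?l, xs ! 0}"
      using dist len \<open>Suc i < length xs\<close>
      by (auto simp: doubleton_eq_iff nth_eq_iff_index_eq[OF dist])
        (subst (asm) nth_eq_iff_index_eq[OF dist]; linarith)
    then have "(x, y) \<in> ?B"
      using xy uv(2) by auto
    then have "(xs ! i, xs ! Suc i) \<in> joined ?B"
      using xy(2) joined_arc joined_sym by (metis doubleton_eq_iff)
    with Suc show ?case
      using joined_trans by (metis Suc_leD)
  qed
  then have "(u, v) \<in> joined ?B"
    using uv(2) joined_sym by (metis doubleton_eq_iff le_refl)
  with assms uv(1) show False
    by (auto simp: bridged_def)
qed

text \<open>If \<open>(u, v)\<close> is no bridge, a simple path leads from \<open>v\<close> to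
  \<open>u\<close> without it. One node means a loop and two nodes mean the reverse arc, both
  against acyclicity; a longer path is closed by the arc to a cycle of the skeleton.\<close>

lemma polytree_imp_bridged:
  assumes "polytree V A"
  shows "bridged A"
  unfolding bridged_def
proof safe
  fix u v assume uv: "(u, v) \<in> A" "(u, v) \<in> joined (A - {(u, v)})"
  then obtain xs where xs: "xs \<noteq> []" "distinct xs" "hd xs = v" "last xs = u"
    and path: "successively (\<lambda>x y. (x, y) \<in> (A - {(u, v)}) \<union> (A - {(u, v)})\<inverse>) xs"
    using joined_path[OF joined_sym] by metis
  have acyc: "acyclic A" and no_cycle: "\<not> undirected_cycle (skeleton A) xs"
    using assms by (auto simp: polytree_def dag_def forest_def)
  have ends: "xs ! 0 = v" "xs ! (length xs - 1) = u"
    using xs by (simp_all add: hd_conv_nth last_conv_nth)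
  have step: "(xs ! i, xs ! Suc i) \<in> (A - {(u, v)}) \<union> (A - {(u, v)})\<inverse>"
    if "Suc i < length xs" for i
    using path that by (rule successively_nth)
  consider "length xs = 1" | "length xs = 2" | "length xs \<ge> 3"
    using xs(1) by (cases "length xs" rule: le_cases[of _ 2]) (force simp: le_Suc_eq numeral_2_eq_2)+
  then show False
  proof cases
    case 1
    then have "(u, u) \<in> A"
      using ends uv(1) by simp
    with acyc show False
      by (auto simp: acyclic_def)
  next
    case 2
    then have "(v, u) \<in> (A - {(u, v)}) \<union> (A - {(u, v)})\<inverse>"
      using step[of 0] ends by simp
    then have "(v, u) \<in> A"
      by auto
    with uv(1) have "(u, u) \<in> A\<^sup>+"
      by (meson trancl.simps)
    with acyc show False
      by (auto simp: acyclic_def)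
  next
    case 3
    have "{xs ! i, xs ! (Suc i mod length xs)} \<in> skeleton A" if i: "i < length xs" for i
    proof (cases "Suc i < length xs")
      case True
      then show ?thesis
        using step[OF True] by (auto simp: skeleton_def insert_commute)
    next
      case False
      then have "Suc i = length xs"
        using i by simp
      then show ?thesis
        using ends uv(1) by (auto simp: skeleton_def simp flip: \<open>Suc i = length xs\<close>)
    qed
    with 3 xs(2) no_cycle show False
      by (simp add: undirected_cycle_def)
  qed
qed

lemma polytree_iff_bridged: "polytree V A \<longleftrightarrow> A \<subseteq> V \<times> V \<and> bridged A"
  using polytree_imp_bridged[of V A] bridged_imp_acyclic[of A] bridged_imp_forest[of A]
  unfolding polytree_def dag_def by argo


section \<open>Feasible arc sets\<close>

lemma feasible_iff:
  "feasible V k A \<longleftrightarrow> A \<subseteq> V \<times> V \<and> bridged A \<and> (\<forall>v \<in> V. card (parents A v) \<le> k)"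
  by (auto simp: feasible_def polytree_iff_bridged)

lemma finite_parents: "finite A \<Longrightarrow> finite (parents A v)"
  by (rule finite_subset[of _ "fst ` A"]) (force simp: parents_def)+

lemma parents_mono: "A \<subseteq> B \<Longrightarrow> parents A v \<subseteq> parents B v"
  by (auto simp: parents_def)

lemma parents_insert:
  "parents (insert (a, b) A) v = (if v = b then insert a (parents A v) else parents A v)"
  by (auto simp: parents_def)

lemma feasible_finite: "finite V \<Longrightarrow> feasible V k A \<Longrightarrow> finite A"
  using finite_subset[of A "V \<times> V"] by (auto simp: feasible_iff)

lemma feasible_subset:
  assumes "finite V" "feasible V k B" "A \<subseteq> B"
  shows "feasible V k A"
proof -
  have "card (parents A v) \<le> card (parents B v)" for v
    using assms by (intro card_mono finite_parents parents_mono feasible_finite)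
  then show ?thesis
    using assms bridged_subset unfolding feasible_iff by (meson le_trans subset_trans)
qed

section \<open>Candidate arcs, weights and exchange under both constraints\<close>

definition extends :: "'a set \<Rightarrow> nat \<Rightarrow> ('a \<times> 'a) set \<Rightarrow> 'a \<times> 'a \<Rightarrow> bool" where
  "extends V k G e \<longleftrightarrow> e \<notin> G \<and> feasible V k (insert e G)"

text \<open>Reduces feasibility of one more arc to two local tests that a program can perform with
  component labels and in-degree counters.\<close>

lemma extends_iff:
  assumes "finite V" "feasible V k G" "a \<in> V" "b \<in> V"
  shows "extends V k G (a, b) \<longleftrightarrow> (a, b) \<notin> joined G \<and> card (parents G b) < k"
proof -
  have fin: "finite (parents G b)"
    using assms by (intro finite_parents feasible_finite)
  have new: "a \<notin> parents G b \<longleftrightarrow> (a, b) \<notin> G"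
    by (simp add: parents_def)
  show ?thesis
  proof
    assume "extends V k G (a, b)"
    then have "(a, b) \<notin> G" "bridged (insert (a, b) G)" "card (parents (insert (a, b) G) b) \<le> k"
      using assms(4) by (auto simp: extends_def feasible_iff)
    then show "(a, b) \<notin> joined G \<and> card (parents G b) < k"
      using fin new bridged_insertD by (fastforce simp: parents_insert)
  next
    assume *: "(a, b) \<notin> joined G \<and> card (parents G b) < k"
    then have "(a, b) \<notin> G"
      using joined_arc[of a b G] by auto
    with * show "extends V k G (a, b)"
      using assms fin new bridged_insert[of G a b] unfolding extends_def feasible_iff
      by (auto simp: parents_insert)
  qed
qed

definition weight :: "('a \<Rightarrow> 'a set \<Rightarrow> real) \<Rightarrow> ('a \<times> 'a) set \<Rightarrow> real" where
  "weight f A = (\<Sum>(u, v) \<in> A. f v {u})"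

text \<open>Additivity splits each local score over the parents, and summing over all heads counts
  every arc once. Additivity applies because a loop is never a bridge, so no node is its own
  parent.\<close>

lemma score_eq_weight:
  assumes "finite V" "additive_scores V f" "feasible V k A"
  shows "score V f A = weight f A"
proof -
  have AV: "A \<subseteq> V \<times> V" and "bridged A"
    using assms(3) by (auto simp: feasible_iff)
  then have irr: "(v, v) \<notin> A" for v
    by (auto simp: bridged_def)
  have "f v (parents A v) = (\<Sum>u \<in> parents A v. f v {u})" if "v \<in> V" for v
  proof -
    have "parents A v \<subseteq> V - {v}"
      using AV irr by (auto simp: parents_def)
    then show ?thesis
      using assms(2) that unfolding additive_scores_def by blast
  qed
  then have "score V f A = (\<Sum>v \<in> V. \<Sum>u \<in> parents A v. f v {u})"
    by (simp add: score_def)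
  also have "\<dots> = (\<Sum>(v, u) \<in> Sigma V (parents A). f v {u})"
    using assms(1,3) by (intro sum.Sigma ballI finite_parents feasible_finite)
  also have "\<dots> = weight f A"
    unfolding weight_def
    by (rule sum.reindex_bij_witness[of _ prod.swap prod.swap]) (use AV in \<open>auto simp: parents_def\<close>)
  finally show ?thesis .
qed

text \<open>Each constraint is repaired by dropping at most one arc of \<open>R\<close>: one on the
  cycle closed by \<open>e\<close>, and one into the head of \<open>e\<close>. Keeping the arcs that
  survive both repairs loses at most two, and both constraints pass to subsets.\<close>

lemma feasible_exchange:
  assumes "finite V" "feasible V k (G \<union> R)" "extends V k G e"
  shows "\<exists>R' \<subseteq> R. card (R - R') \<le> 2 \<and> feasible V k (insert e (G \<union> R')) \<and> e \<notin> R'"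
proof (cases "e \<in> R")
  case True
  then have "insert e (G \<union> (R - {e})) = G \<union> R" "R - (R - {e}) = {e}"
    by auto
  with assms(2) show ?thesis
    by (intro exI[of _ "R - {e}"]) auto
next
  case False
  obtain a b where e: "e = (a, b)"
    by fastforce
  have eG: "e \<notin> G" and fe: "feasible V k (insert e G)"
    using assms(3) by (auto simp: extends_def)
  have fin: "finite (G \<union> R)"
    using assms by (intro feasible_finite)
  have ab: "a \<in> V" "b \<in> V"
    using fe e by (auto simp: feasible_iff)
  have "(a, b) \<notin> joined G"
    using fe e eG by (auto simp: feasible_iff dest: bridged_insertD)
  then obtain R1 where R1: "R1 \<subseteq> R" "card (R - R1) \<le> 1" "bridged (insert e (G \<union> R1))"
    using bridged_exchange[of R G a b] assms(2) fin e by (auto simp: feasible_iff)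
  have in_degree: "card (parents (G \<union> R) v) \<le> k" if "v \<in> V" for v
    using assms(2) that by (auto simp: feasible_iff)
  obtain R2 where R2: "R2 \<subseteq> R" "card (R - R2) \<le> 1" "card (parents (insert e (G \<union> R2)) b) \<le> k"
  proof (cases "card (parents (insert e (G \<union> R)) b) \<le> k")
    case True
    then show ?thesis
      by (intro that[of R]) auto
  next
    case False
    \<comment> \<open>Otherwise all arcs into \<open>b\<close> would lie in
      \<open>insert e G\<close>, which respects the bound. As \<open>(c, b)\<close> is outside that
      set, removing it from \<open>R\<close> removes it from the union.\<close>
    have "\<exists>c. (c, b) \<in> R \<and> (c, b) \<notin> insert e G"
    proof (rule ccontr)
      assume "\<not> ?thesis"
      then have "parents (insert e (G \<union> R)) b = parents (insert e G) b"
        by (auto simp: parents_def)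
      then show False
        using False fe ab by (auto simp: feasible_iff)
    qed
    then obtain c where c: "(c, b) \<in> R" "(c, b) \<notin> insert e G"
      by blast
    have "parents (insert e (G \<union> (R - {(c, b)}))) b = insert a (parents (G \<union> R) b - {c})"
      using c e by (auto simp: parents_def)
    \<comment> \<open>The parent \<open>a\<close> takes the place of \<open>c\<close>, so the
      in-degree of \<open>b\<close> is at most that in \<open>G \<union> R\<close>.\<close>
    moreover have "card (insert a (parents (G \<union> R) b - {c})) \<le> Suc (card (parents (G \<union> R) b - {c}))"
      by (simp add: card_insert_if finite_parents[OF fin])
    moreover have "Suc (card (parents (G \<union> R) b - {c})) = card (parents (G \<union> R) b)"
      using c(1) by (intro card_Suc_Diff1 finite_parents[OF fin]) (auto simp: parents_def)
    ultimately have "card (parents (insert e (G \<union> (R - {(c, b)}))) b) \<le> k"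
      using in_degree[OF ab(2)] by simp
    moreover have "R - (R - {(c, b)}) = {(c, b)}"
      using c(1) by auto
    ultimately show ?thesis
      by (intro that[of "R - {(c, b)}"]) auto
  qed
  let ?R = "R1 \<inter> R2"
  have "card (R - ?R) \<le> card (R - R1) + card (R - R2)"
    by (metis Diff_Int card_Un_le)
  then have "card (R - ?R) \<le> 2"
    using R1(2) R2(2) by linarith
  moreover have "feasible V k (insert e (G \<union> ?R))"
    unfolding feasible_iff
  proof (intro conjI ballI)
    show "insert e (G \<union> ?R) \<subseteq> V \<times> V"
      using assms(2) R1(1) e ab by (auto simp: feasible_iff)
    show "bridged (insert e (G \<union> ?R))"
      using R1(3) by (rule bridged_subset) auto
    fix v assume v: "v \<in> V"
    have fin2: "finite (insert e (G \<union> R2))"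
      using fin R2(1) finite_subset by auto
    show "card (parents (insert e (G \<union> ?R)) v) \<le> k"
    proof (cases "v = b")
      case True
      have "card (parents (insert e (G \<union> ?R)) b) \<le> card (parents (insert e (G \<union> R2)) b)"
        by (intro card_mono finite_parents fin2 parents_mono) auto
      with True R2(3) show ?thesis
        by simp
    next
      case False
      then have "parents (insert e (G \<union> ?R)) v \<subseteq> parents (G \<union> R) v"
        using e R1(1) by (auto simp: parents_def)
      then have "card (parents (insert e (G \<union> ?R)) v) \<le> card (parents (G \<union> R) v)"
        by (intro card_mono finite_parents[OF fin])
      with in_degree[OF v] show ?thesis
        by simp
    qed
  qed
  ultimately show ?thesis
    using R1(1) False by (intro exI[of _ ?R]) auto
qed


section \<open>The greedy algorithm\<close>

text \<open>Ties are left open, so any scan order fits. Every initial stretch of a run qualifies;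
  that no positive candidate is left is a separate condition.\<close>

inductive greedy :: "'a set \<Rightarrow> nat \<Rightarrow> ('a \<Rightarrow> 'a set \<Rightarrow> real) \<Rightarrow> ('a \<times> 'a) set \<Rightarrow> bool"
  for V k f where
  greedy_empty: "greedy V k f {}"
| greedy_insert: "greedy V k f G \<Longrightarrow> extends V k G (a, b) \<Longrightarrow> 0 < f b {a} \<Longrightarrow>
    (\<And>u v. extends V k G (u, v) \<Longrightarrow> f v {u} \<le> f b {a}) \<Longrightarrow> greedy V k f (insert (a, b) G)"

lemma greedy_feasible: "greedy V k f G \<Longrightarrow> feasible V k G"
  by (induction rule: greedy.induct) (auto simp: feasible_empty extends_def)

text \<open>\<open>R\<close> starts as \<open>D\<close> and loses at most two arcs per round, whose
  weight is charged to twice the weight of the new arc.\<close>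

lemma greedy_residual:
  assumes "greedy V k f G" "finite V" "feasible V k D"
  shows "\<exists>R. G \<inter> R = {} \<and> feasible V k (G \<union> R) \<and> weight f D \<le> 2 * weight f G + weight f R"
  using assms(1)
proof (induction rule: greedy.induct)
  case greedy_empty
  show ?case
    using assms(3) by (intro exI[of _ D]) (simp add: weight_def)
next
  case (greedy_insert G a b)
  then obtain R where R: "G \<inter> R = {}" "feasible V k (G \<union> R)"
    "weight f D \<le> 2 * weight f G + weight f R"
    by blast
  obtain R' where R': "R' \<subseteq> R" "card (R - R') \<le> 2" "feasible V k (insert (a, b) (G \<union> R'))"
    "(a, b) \<notin> R'"
    using feasible_exchange[OF assms(2) R(2) greedy_insert.hyps(2)] by blast
  have fin: "finite (G \<union> R)"
    using assms(2) R(2) by (rule feasible_finite)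
  \<comment> \<open>Every arc of \<open>R\<close> was a candidate, because \<open>G\<close> with
    that arc lies inside the feasible set \<open>G \<union> R\<close>.\<close>
  have "f v {u} \<le> f b {a}" if "(u, v) \<in> R" for u v
  proof (rule greedy_insert.hyps(4))
    have "feasible V k (insert (u, v) G)"
      using that by (intro feasible_subset[OF assms(2) R(2)]) auto
    then show "extends V k G (u, v)"
      using that R(1) by (auto simp: extends_def)
  qed
  then have "weight f (R - R') \<le> of_nat (card (R - R')) * f b {a}"
    unfolding weight_def by (intro sum_bounded_above) auto
  \<comment> \<open>Fewer than two arcs may have been dropped; the factor 2 is still safe because
    the new arc has positive weight.\<close>
  also have "\<dots> \<le> 2 * f b {a}"
    using R'(2) greedy_insert.hyps(3) by (intro mult_right_mono) auto
  finally have "weight f R \<le> weight f R' + 2 * f b {a}"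
    using sum.subset_diff[OF R'(1), of "\<lambda>(u, v). f v {u}"] fin by (simp add: weight_def)
  moreover have "weight f (insert (a, b) G) = f b {a} + weight f G"
    using greedy_insert.hyps(2) fin by (simp add: weight_def extends_def)
  ultimately show ?case
    using R R' by (intro exI[of _ R']) auto
qed

lemma greedy_two_approximation:
  assumes "finite V" "additive_scores V f" "greedy V k f G" "feasible V k D"
    and stop: "\<And>u v. extends V k G (u, v) \<Longrightarrow> f v {u} \<le> 0"
  shows "score V f D \<le> 2 * score V f G"
proof -
  obtain R where R: "G \<inter> R = {}" "feasible V k (G \<union> R)"
    "weight f D \<le> 2 * weight f G + weight f R"
    using greedy_residual[OF assms(3,1,4)] by blast
  have "f v {u} \<le> 0" if "(u, v) \<in> R" for u v
  proof (rule stop)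
    have "feasible V k (insert (u, v) G)"
      using that by (intro feasible_subset[OF assms(1) R(2)]) auto
    then show "extends V k G (u, v)"
      using that R(1) by (auto simp: extends_def)
  qed
  then have "weight f R \<le> 0"
    unfolding weight_def by (intro sum_nonpos) auto
  with R(3) show ?thesis
    using score_eq_weight[OF assms(1,2)] assms(4) greedy_feasible[OF assms(3)] by simp
qed


section \<open>Total correctness with step bounds\<close>

text \<open>The start state comes last so that one \<open>runs\<close> can serve as the
  postcondition of another, as in the rule for \<open>Seq\<close>.\<close>

definition runs :: "com \<Rightarrow> nat \<Rightarrow> (state \<Rightarrow> bool) \<Rightarrow> state \<Rightarrow> bool" where
  "runs c T Q s \<longleftrightarrow> (\<exists>t s'. exec c s t s' \<and> t \<le> T \<and> Q s')"

lemma runs_conseq: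
  "runs c T P s \<Longrightarrow> T \<le> T' \<Longrightarrow> (\<And>s'. P s' \<Longrightarrow> Q s') \<Longrightarrow> runs c T' Q s"
  unfolding runs_def by (meson le_trans)

lemma runs_Skip: "Q s \<Longrightarrow> runs Skip 1 Q s"
  unfolding runs_def by (blast intro: exec.Skip)

lemma runs_NSet: "Q (nwrite x (nval d s) (nval e s) s) \<Longrightarrow> runs (NSet x d e) 1 Q s"
  unfolding runs_def by (blast intro: exec.NSet)

lemma runs_RSet: "Q (rwrite x (nval d s) (rval e s) s) \<Longrightarrow> runs (RSet x d e) 1 Q s"
  unfolding runs_def by (blast intro: exec.RSet)

lemma runs_Seq: "runs c T (runs d T' Q) s \<Longrightarrow> runs (Seq c d) (T + T') Q s"
  unfolding runs_def by (meson exec.Seq add_mono)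

lemma runs_Cond:
  assumes "tval b s \<Longrightarrow> runs c T Q s" "\<not> tval b s \<Longrightarrow> runs d T' Q s"
  shows "runs (Cond b c d) (1 + max T T') Q s"
proof (cases "tval b s")
  case True
  with assms(1) obtain t s' where "exec c s t s'" "t \<le> T" "Q s'"
    by (auto simp: runs_def)
  moreover from this(1) have "exec (Cond b c d) s (1 + t) s'"
    using True by (intro exec.CondTrue)
  moreover have "1 + t \<le> 1 + max T T'"
    using \<open>t \<le> T\<close> by simp
  ultimately show ?thesis
    unfolding runs_def by blast
next
  case False
  with assms(2) obtain t s' where "exec d s t s'" "t \<le> T'" "Q s'"
    by (auto simp: runs_def)
  moreover from this(1) have "exec (Cond b c d) s (1 + t) s'"
    using False by (intro exec.CondFalse)
  moreover have "1 + t \<le> 1 + max T T'"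
    using \<open>t \<le> T'\<close> by simp
  ultimately show ?thesis
    unfolding runs_def by blast
qed

text \<open>The measure \<open>\<mu>\<close> bounds the number of rounds, each costing one test and
  at most \<open>T\<close> steps; the leading 1 is the final failing test.\<close>

lemma runs_While:
  assumes body: "\<And>s. I s \<Longrightarrow> tval b s \<Longrightarrow> runs c T (\<lambda>s'. I s' \<and> \<mu> s' < \<mu> s) s"
    and "I s"
  shows "runs (While b c) (1 + \<mu> s * (1 + T)) (\<lambda>s'. I s' \<and> \<not> tval b s') s"
  using \<open>I s\<close>
proof (induction "\<mu> s" arbitrary: s rule: less_induct)
  case less
  show ?case
  proof (cases "tval b s")
    case False
    then have "exec (While b c) s 1 s"
      by (rule exec.WhileFalse)
    with False less.prems show ?thesis
      unfolding runs_def by force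
  next
    case True
    then obtain t s' where 1: "exec c s t s'" "t \<le> T" "I s'" "\<mu> s' < \<mu> s"
      using body[OF less.prems] by (auto simp: runs_def)
    then obtain t' s'' where 2: "exec (While b c) s' t' s''" "t' \<le> 1 + \<mu> s' * (1 + T)"
      "I s''" "\<not> tval b s''"
      using less.hyps[of s'] by (auto simp: runs_def)
    have "1 + t + t' \<le> 1 + Suc (\<mu> s') * (1 + T)"
      using 1(2) 2(2) by simp
    also have "\<dots> \<le> 1 + \<mu> s * (1 + T)"
      using 1(4) by (intro add_left_mono mult_le_mono1) simp
    finally show ?thesis
      unfolding runs_def using exec.WhileTrue[OF True 1(1) 2(1)] 2(3,4) by blast
  qed
qed

abbreviation var :: "name \<Rightarrow> nexp" where
  "var x \<equiv> NGet x (NConst 0)"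

abbreviation assign :: "name \<Rightarrow> nexp \<Rightarrow> com" where
  "assign x e \<equiv> NSet x (NConst 0) e"

abbreviation increment :: "name \<Rightarrow> com" where
  "increment x \<equiv> assign x (NAdd (var x) (NConst 1))"

text \<open>This is equality, not its negation; tests on numbers offer only
  \<open>NLess\<close>.\<close>

abbreviation NEq :: "nexp \<Rightarrow> nexp \<Rightarrow> test" where
  "NEq d e \<equiv> Conj (Neg (NLess d e)) (Neg (NLess e d))"

text \<open>The index of the invariant is the counter value, so a body leading from
  \<open>I i\<close> to \<open>I (Suc i)\<close> must itself advance the counter, and
  \<open>n\<close> rounds follow.\<close>

lemma runs_for:
  assumes body: "\<And>i s. i < n \<Longrightarrow> I i s \<Longrightarrow> runs c T (I (Suc i)) s"
    and counter: "\<And>i s. I i s \<Longrightarrow> nats s x 0 = i \<and> nats s ''n'' 0 = n"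
    and init: "I 0 s"
  shows "runs (While (NLess (var x) (var ''n'')) c) (1 + n * (1 + T)) (I n) s"
proof -
  let ?b = "NLess (var x) (var ''n'')"
  let ?I = "\<lambda>s. \<exists>i \<le> n. I i s" and ?\<mu> = "\<lambda>s. n - nats s x 0"
  have "runs (While ?b c) (1 + ?\<mu> s * (1 + T)) (\<lambda>s'. ?I s' \<and> \<not> tval ?b s') s"
  proof (rule runs_While)
    show "?I s"
      using init by blast
    fix s assume "?I s" "tval ?b s"
    then obtain i where i: "I i s" "i < n"
      using counter by fastforce
    show "runs c T (\<lambda>s'. ?I s' \<and> ?\<mu> s' < ?\<mu> s) s"
      using body[OF i(2,1)]
    proof (rule runs_conseq)
      fix s' assume "I (Suc i) s'"
      then show "?I s' \<and> ?\<mu> s' < ?\<mu> s"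
        using i counter[OF i(1)] counter[of "Suc i" s'] by (auto intro!: exI[of _ "Suc i"])
    qed simp
  qed
  then show ?thesis
  proof (rule runs_conseq)
    fix s' assume "?I s' \<and> \<not> tval ?b s'"
    then obtain i where "i \<le> n" "I i s'" "\<not> nats s' x 0 < nats s' ''n'' 0"
      by auto
    then show "I n s'"
      using counter[of i s'] by auto
  qed (use counter[OF init] in simp)
qed

lemma nats_nwrite [simp]:
  "nats (nwrite x i m s) y = (if y = x then (nats s x)(i := m) else nats s y)"
  by (simp add: nwrite_def)

lemma reals_nwrite [simp]: "reals (nwrite x i m s) = reals s"
  by (simp add: nwrite_def)

lemma reals_rwrite [simp]:
  "reals (rwrite x i r s) y = (if y = x then (reals s x)(i := r) else reals s y)"
  by (simp add: rwrite_def)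

lemma nats_rwrite [simp]: "nats (rwrite x i r s) = nats s"
  by (simp add: rwrite_def)


section \<open>The greedy program\<close>

text \<open>
  Two nodes have the same entry in \<open>comp\<close> iff they lie in the same component of the current forest,
  so that an arc closes no cycle iff its ends have different entries. The index \<open>i\<close> runs through
  the values \<open>v * n + u\<close> along with \<open>u\<close> and \<open>v\<close>, which avoids the multiplication. The flag \<open>go\<close>
  is set iff the scan found an admissible arc of positive weight.
\<close>

definition init_labels :: com where
  "init_labels = While (NLess (var ''v'') (var ''n''))
     (Seq (NSet ''comp'' (var ''v'') (var ''v'')) (increment ''v''))"

definition test_arc :: com where
  "test_arc =
     Cond (Conj (Neg (NEq (NGet ''comp'' (var ''u'')) (NGet ''comp'' (var ''v''))))
            (Conj (NLess (NGet ''indeg'' (var ''v'')) (var ''k''))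
              (RLess (RGet ''best'' (NConst 0)) (RGet ''f'' (var ''i'')))))
       (Seq (RSet ''best'' (NConst 0) (RGet ''f'' (var ''i'')))
         (Seq (assign ''bu'' (var ''u'')) (Seq (assign ''bv'' (var ''v''))
           (assign ''go'' (NConst 1)))))
       Skip"

definition scan :: com where
  "scan = Seq (assign ''go'' (NConst 0)) (Seq (RSet ''best'' (NConst 0) RZero)
     (Seq (assign ''i'' (NConst 0)) (Seq (assign ''v'' (NConst 0))
       (While (NLess (var ''v'') (var ''n''))
         (Seq (assign ''u'' (NConst 0))
           (Seq (While (NLess (var ''u'') (var ''n''))
                  (Seq test_arc (Seq (increment ''i'') (increment ''u''))))
             (increment ''v'')))))))"

definition add_arc :: com where
  "add_arc = Seq (NSet ''tail'' (var ''m'') (var ''bu''))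
     (Seq (NSet ''head'' (var ''m'') (var ''bv''))
     (Seq (increment ''m'')
     (Seq (NSet ''indeg'' (var ''bv'') (NAdd (NGet ''indeg'' (var ''bv'')) (NConst 1)))
     (Seq (assign ''old'' (NGet ''comp'' (var ''bv'')))
     (Seq (assign ''new'' (NGet ''comp'' (var ''bu'')))
     (Seq (assign ''w'' (NConst 0))
       (While (NLess (var ''w'') (var ''n''))
         (Seq (Cond (NEq (NGet ''comp'' (var ''w'')) (var ''old''))
                (NSet ''comp'' (var ''w'') (var ''new'')) Skip)
           (increment ''w'')))))))))"

definition greedy_prog :: com where
  "greedy_prog = Seq init_labels (Seq (assign ''go'' (NConst 1))
     (While (NLess (NConst 0) (var ''go''))
       (Seq scan (Cond (NLess (NConst 0) (var ''go'')) add_arc Skip))))"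

section \<open>Invariants linking the memory to the arc set\<close>

definition labels :: "nat \<Rightarrow> (nat \<times> nat) set \<Rightarrow> (nat \<Rightarrow> nat) \<Rightarrow> bool" where
  "labels n G c \<longleftrightarrow> (\<forall>u < n. \<forall>v < n. c u = c v \<longleftrightarrow> (u, v) \<in> joined G)"

text \<open>Giving the class of \<open>b\<close> the label of \<open>a\<close> merges the same two
  components as \<open>joined_insert\<close>. The guard \<open>w < n\<close> matches a loop over the
  node indices.\<close>

lemma labels_insert:
  assumes "labels n G c" "a < n" "b < n"
  shows "labels n (insert (a, b) G) (\<lambda>w. if w < n \<and> c w = c b then c a else c w)"
proof -
  have lab: "(u, v) \<in> joined G \<longleftrightarrow> c u = c v" if "u < n" "v < n" for u v
    using assms(1) that by (simp add: labels_def)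
  show ?thesis
    using assms(2,3) by (auto simp: labels_def joined_insert lab)
qed

text \<open>That \<open>m\<close> is both the list length and \<open>card G\<close> means that the
  output list has no repetitions, so \<open>m\<close> measures progress.\<close>

definition stores ::
    "nat \<Rightarrow> nat \<Rightarrow> (nat \<Rightarrow> nat set \<Rightarrow> real) \<Rightarrow> (nat \<times> nat) set \<Rightarrow> state \<Rightarrow> bool" where
  "stores n k f G s \<longleftrightarrow> nats s ''n'' 0 = n \<and> nats s ''k'' 0 = k \<and>
     (\<forall>u < n. \<forall>v < n. u \<noteq> v \<longrightarrow> reals s ''f'' (v * n + u) = f v {u}) \<and>
     output_arcs s = G \<and> nats s ''m'' 0 = card G \<and>
     (\<forall>v < n. nats s ''indeg'' v = card (parents G v))"

lemma stores_cong:
  assumes "\<forall>x \<in> {''n'', ''k'', ''m'', ''tail'', ''head'', ''indeg''}. nats s' x = nats s x"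
    and "reals s' ''f'' = reals s ''f''"
  shows "stores n k f G s' \<longleftrightarrow> stores n k f G s"
  using assms by (simp add: stores_def output_arcs_def)

lemma stores_nwrite [simp]:
  "x \<notin> {''n'', ''k'', ''m'', ''tail'', ''head'', ''indeg''} \<Longrightarrow>
     stores n k f G (nwrite x i m s) \<longleftrightarrow> stores n k f G s"
  by (rule stores_cong) auto

lemma stores_rwrite [simp]:
  "x \<noteq> ''f'' \<Longrightarrow> stores n k f G (rwrite x i r s) \<longleftrightarrow> stores n k f G s"
  by (rule stores_cong) auto

lemma storesD:
  assumes "stores n k f G s"
  shows "nats s ''n'' 0 = n" "nats s ''k'' 0 = k" "nats s ''m'' 0 = card G" "output_arcs s = G"
    and "u < n \<Longrightarrow> v < n \<Longrightarrow> u \<noteq> v \<Longrightarrow> reals s ''f'' (v * n + u) = f v {u}"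
    and "v < n \<Longrightarrow> nats s ''indeg'' v = card (parents G v)"
  using assms by (auto simp: stores_def)

section \<open>Correctness of the components of the program\<close>

lemma init_labels_correct:
  "runs init_labels (1 + n * 3) (\<lambda>s. stores n k f {} s \<and> labels n {} (nats s ''comp''))
     (input_state n k f)"
proof -
  let ?I = "\<lambda>i s. stores n k f {} s \<and> nats s ''v'' 0 = i \<and> (\<forall>w < i. nats s ''comp'' w = w)"
  have "runs init_labels (1 + n * (1 + (1 + 1))) (?I n) (input_state n k f)"
    unfolding init_labels_def
  proof (rule runs_for[where I = ?I])
    fix i s assume "?I i s"
    then show "runs (Seq (NSet ''comp'' (var ''v'') (var ''v'')) (increment ''v'')) (1 + 1)
        (?I (Suc i)) s"
      by (intro runs_Seq runs_NSet) (auto simp: less_Suc_eq)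
  next
    \<comment> \<open>Memory that is 0 apart from the input encodes the empty arc set with all
      in-degrees 0, and has the counter \<open>v\<close> at 0.\<close>
    have "stores n k f {} (input_state n k f)"
      unfolding stores_def using input_state_score
      by (auto simp: output_arcs_def input_state_def parents_def)
    then show "?I 0 (input_state n k f)"
      by (simp add: input_state_def)
  qed (auto simp: stores_def)
  then show ?thesis
    by (rule runs_conseq) (auto simp: labels_def joined_empty)
qed

text \<open>For feasible \<open>G\<close> and nodes below \<open>n\<close> this agrees with
  \<open>extends\<close>, but it can be read off the stored labels and in-degrees.\<close>

definition admissible :: "nat \<Rightarrow> (nat \<times> nat) set \<Rightarrow> nat \<times> nat \<Rightarrow> bool" where
  "admissible k G e \<longleftrightarrow> e \<notin> joined G \<and> card (parents G (snd e)) < k"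

text \<open>\<open>E\<close> holds the pairs examined so far. The threshold \<open>best\<close>
  starts at 0, so \<open>go\<close> being 0 means that no admissible arc in \<open>E\<close> has
  positive score.\<close>

definition scanned ::
    "nat \<Rightarrow> nat \<Rightarrow> (nat \<Rightarrow> nat set \<Rightarrow> real) \<Rightarrow> (nat \<times> nat) set \<Rightarrow> (nat \<times> nat) set \<Rightarrow> state \<Rightarrow> bool"
  where "scanned n k f G E s \<longleftrightarrow> stores n k f G s \<and> labels n G (nats s ''comp'') \<and>
     (\<forall>(a, b) \<in> E. admissible k G (a, b) \<longrightarrow> f b {a} \<le> reals s ''best'' 0) \<and>
     (let a = nats s ''bu'' 0; b = nats s ''bv'' 0 in
      if nats s ''go'' 0 = 0 then reals s ''best'' 0 = 0
      else a < n \<and> b < n \<and> admissible k G (a, b) \<and> reals s ''best'' 0 = f b {a} \<and> 0 < f b {a})"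

lemma scanned_nwrite [simp]:
  "x \<in> {''u'', ''v'', ''i''} \<Longrightarrow> scanned n k f G E (nwrite x i m s) \<longleftrightarrow> scanned n k f G E s"
  by (elim insertE) (simp_all add: scanned_def)

lemma test_arc_correct:
  assumes "scanned n k f G E s" "nats s ''u'' 0 = u" "nats s ''v'' 0 = v"
    and "nats s ''i'' 0 = v * n + u" "u < n" "v < n"
  shows "runs test_arc 5 (\<lambda>s'. scanned n k f G (insert (u, v) E) s' \<and> nats s' ''u'' 0 = u \<and>
    nats s' ''v'' 0 = v \<and> nats s' ''i'' 0 = v * n + u) s"
proof -
  have st: "stores n k f G s" and lab: "labels n G (nats s ''comp'')"
    using assms(1) by (auto simp: scanned_def)
  have adm: "admissible k G (u, v) \<longleftrightarrow>
      nats s ''comp'' u \<noteq> nats s ''comp'' v \<and> nats s ''indeg'' v < k"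
    using lab storesD(6)[OF st assms(6)] assms(5,6) by (auto simp: admissible_def labels_def)
  \<comment> \<open>On the diagonal the array need not hold a score, but a pair
    \<open>(u, u)\<close> is never admissible.\<close>
  have score: "reals s ''f'' (v * n + u) = f v {u}" if "admissible k G (u, v)"
    using storesD(5)[OF st assms(5,6)] that by (cases "u = v") (auto simp: admissible_def)
  \<comment> \<open>Since \<open>best\<close> is nonnegative, an arc that beats it strictly has
    positive score.\<close>
  have nonneg: "0 \<le> reals s ''best'' 0"
    using assms(1) by (auto simp: scanned_def Let_def split: if_splits)
  let ?Q = "\<lambda>s'. scanned n k f G (insert (u, v) E) s' \<and> nats s' ''u'' 0 = u \<and>
    nats s' ''v'' 0 = v \<and> nats s' ''i'' 0 = v * n + u"
  have "runs test_arc (1 + max (1 + (1 + (1 + 1))) 1) ?Q s"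
    unfolding test_arc_def
    apply (intro runs_Cond runs_Seq runs_NSet runs_RSet runs_Skip)
    subgoal
      using assms adm score nonneg storesD(2)[OF st] by (fastforce simp: scanned_def Let_def)
    subgoal
      using assms adm score storesD(2)[OF st] by (auto simp: scanned_def)
    done
  then show ?thesis
    by (rule runs_conseq) auto
qed

lemma scan_correct:
  assumes "stores n k f G s" "labels n G (nats s ''comp'')"
  shows "runs scan (5 + n * (4 + n * 8)) (scanned n k f G ({..<n} \<times> {..<n})) s"
proof -
  let ?J = "\<lambda>v u s. scanned n k f G ({..<n} \<times> {..<v} \<union> {..<u} \<times> {v}) s \<and>
    nats s ''v'' 0 = v \<and> nats s ''u'' 0 = u \<and> nats s ''i'' 0 = v * n + u"
  \<comment> \<open>The index \<open>i\<close> is not reset between rows: \<open>v * n + n\<close>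
    at the end of a row is the start of the next.\<close>
  let ?I = "\<lambda>v s. scanned n k f G ({..<n} \<times> {..<v}) s \<and>
    nats s ''v'' 0 = v \<and> nats s ''i'' 0 = v * n"
  have n: "nats s ''n'' 0 = n" if "scanned n k f G E s" for E s
    using that by (simp add: scanned_def stores_def)
  have inner: "runs (While (NLess (var ''u'') (var ''n''))
      (Seq test_arc (Seq (increment ''i'') (increment ''u'')))) (1 + n * (1 + 7)) (?J v n) s"
    if v: "v < n" and init: "?J v 0 s" for v s
  proof (rule runs_for[where I = "?J v"])
    fix u s assume u: "u < n" "?J v u s"
    let ?E = "{..<n} \<times> {..<v} \<union> {..<u} \<times> {v}"
    have eq: "insert (u, v) ?E = {..<n} \<times> {..<v} \<union> {..<Suc u} \<times> {v}"
      by auto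
    have "runs (Seq test_arc (Seq (increment ''i'') (increment ''u''))) (5 + (1 + 1))
        (?J v (Suc u)) s"
      apply (rule runs_Seq)
      apply (rule runs_conseq[OF test_arc_correct[of n k f G ?E s u v]])
             apply (use u v in simp_all)[7]
      apply (intro runs_Seq runs_NSet)
      apply (simp add: eq)
      done
    then show "runs (Seq test_arc (Seq (increment ''i'') (increment ''u''))) 7 (?J v (Suc u)) s"
      by simp
  qed (use n init in auto)
  have outer: "runs (Seq (assign ''u'' (NConst 0))
      (Seq (While (NLess (var ''u'') (var ''n''))
        (Seq test_arc (Seq (increment ''i'') (increment ''u'')))) (increment ''v'')))
      (1 + ((1 + n * (1 + 7)) + 1)) (?I (Suc v)) s"
    if v: "v < n" "?I v s" for v s
  proof (intro runs_Seq runs_NSet)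
    let ?s = "nwrite ''u'' (nval (NConst 0) s) (nval (NConst 0) s) s"
    have eq: "{..<n} \<times> {..<v} \<union> {..<n} \<times> {v} = {..<n} \<times> {..<Suc v}"
      by auto
    have "?J v 0 ?s"
      using v by simp
    then show "runs (While (NLess (var ''u'') (var ''n''))
        (Seq test_arc (Seq (increment ''i'') (increment ''u'')))) (1 + n * (1 + 7))
        (runs (increment ''v'') 1 (?I (Suc v))) ?s"
      by (intro runs_conseq[OF inner[OF v(1)]] runs_NSet) (auto simp: eq)
  qed
  have "runs scan (1 + (1 + (1 + (1 + (1 + n * (1 + (1 + ((1 + n * (1 + 7)) + 1)))))))) (?I n) s"
    unfolding scan_def
    apply (intro runs_Seq runs_NSet runs_RSet)
    apply (rule runs_for[where I = ?I, OF outer])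
    subgoal by assumption
    subgoal by assumption
    subgoal using n by blast
    subgoal using assms by (simp add: scanned_def)
    done
  then show ?thesis
    by (rule runs_conseq) (auto simp: algebra_simps)
qed

lemma add_arc_correct:
  assumes st: "stores n k f G s" and lab: "labels n G (nats s ''comp'')" and fin: "finite G"
    and ab: "nats s ''bu'' 0 = a" "nats s ''bv'' 0 = b" "a < n" "b < n" "(a, b) \<notin> G"
  shows "runs add_arc (8 + n * 4) (\<lambda>s'. stores n k f (insert (a, b) G) s' \<and>
    labels n (insert (a, b) G) (nats s' ''comp'') \<and> nats s' ''go'' = nats s ''go'') s"
proof -
  define c where "c = nats s ''comp''"
  let ?G = "insert (a, b) G"
  \<comment> \<open>Stated with the labels \<open>c\<close> from before the loop. The loop may
    overwrite the entry of \<open>b\<close> under way, so both labels are saved in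
    \<open>old\<close> and \<open>new\<close>.\<close>
  let ?I = "\<lambda>i s'. stores n k f ?G s' \<and> nats s' ''w'' 0 = i \<and> nats s' ''old'' 0 = c b \<and>
    nats s' ''new'' 0 = c a \<and> nats s' ''go'' = nats s ''go'' \<and>
    nats s' ''comp'' = (\<lambda>w. if w < i \<and> c w = c b then c a else c w)"
  have body: "runs (Seq (Cond (NEq (NGet ''comp'' (var ''w'')) (var ''old''))
      (NSet ''comp'' (var ''w'') (var ''new'')) Skip) (increment ''w'')) (1 + max 1 1 + 1)
      (?I (Suc i)) s'" if "i < n" "?I i s'" for i s'
    using that(2) by (intro runs_Seq runs_Cond runs_NSet runs_Skip) (auto simp: fun_eq_iff less_Suc_eq)
  have indeg: "card (parents ?G v) = (if v = b then Suc (card (parents G v)) else card (parents G v))"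
    for v
    using ab(5) finite_parents[OF fin] by (auto simp: parents_insert) (auto simp: parents_def)
  \<comment> \<open>The memory after the four writes that record the arc; the later writes touch
    nothing that \<open>stores\<close> reads.\<close>
  let ?s = "nwrite ''indeg'' b (nats s ''indeg'' b + 1) (nwrite ''m'' 0 (card G + 1)
    (nwrite ''head'' (card G) b (nwrite ''tail'' (card G) a s)))"
  have "output_arcs ?s = insert (a, b) (output_arcs s)"
    using storesD(3)[OF st] by (auto simp: output_arcs_def less_Suc_eq) (metis less_irrefl_nat)
  then have "stores n k f ?G ?s"
    using st ab fin by (simp add: stores_def indeg)
  then have "runs add_arc (1 + (1 + (1 + (1 + (1 + (1 + (1 + (1 + n * (1 + (1 + max 1 1 + 1))))))))))
      (?I n) s"
    unfolding add_arc_def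
    apply (intro runs_Seq runs_NSet)
    apply (rule runs_for[where I = ?I, OF body])
    using storesD[OF st] ab apply (simp_all add: c_def)
    apply (simp add: stores_def)
    done
  then show ?thesis
    by (rule runs_conseq) (use labels_insert[OF lab[folded c_def] ab(3,4)] in auto)
qed

section \<open>Termination, step bound and stopping condition of the whole program\<close>

lemma greedy_prog_correct:
  "runs greedy_prog (3 + n * 3 + (1 + n * n) * (15 + n * 8 + n * n * 8))
     (\<lambda>s. greedy {..<n} k f (output_arcs s) \<and>
        (\<forall>u v. extends {..<n} k (output_arcs s) (u, v) \<longrightarrow> f v {u} \<le> 0)) (input_state n k f)"
proof -
  let ?stop = "\<lambda>G. \<forall>u v. extends {..<n} k G (u, v) \<longrightarrow> f v {u} \<le> 0"
  \<comment> \<open>The last clause carries the stopping condition out of the loop; it holds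
    vacuously at the start, where \<open>go\<close> is set to 1.\<close>
  let ?J = "\<lambda>G s. greedy {..<n} k f G \<and> stores n k f G s \<and> labels n G (nats s ''comp'') \<and>
    (nats s ''go'' 0 = 0 \<longrightarrow> ?stop G)"
  let ?I = "\<lambda>s. \<exists>G. ?J G s"
  \<comment> \<open>A round either stores a new arc, of which there are at most
    \<open>n * n\<close>, or clears \<open>go\<close>. The \<open>Suc\<close> keeps the measure
    positive while \<open>go\<close> is set, so clearing it is a decrease too.\<close>
  let ?\<mu> = "\<lambda>s. if nats s ''go'' 0 = 0 then 0 else Suc (n * n) - nats s ''m'' 0"
  let ?T = "5 + n * (4 + n * 8) + (1 + max (8 + n * 4) 1)"
  let ?body = "Seq scan (Cond (NLess (NConst 0) (var ''go'')) add_arc Skip)"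
  have body: "runs ?body ?T (\<lambda>s'. ?I s' \<and> ?\<mu> s' < ?\<mu> s) s"
    if "?I s" "tval (NLess (NConst 0) (var ''go'')) s" for s
  proof -
    obtain G where G: "greedy {..<n} k f G" "stores n k f G s" "labels n G (nats s ''comp'')"
      using \<open>?I s\<close> by blast
    have feas: "feasible {..<n} k G"
      using G(1) by (rule greedy_feasible)
    then have sub: "G \<subseteq> {..<n} \<times> {..<n}"
      by (simp add: feasible_iff)
    then have fin: "finite G"
      using finite_subset by blast
    have "card G \<le> n * n"
      using card_mono[OF _ sub] by (simp add: card_cartesian_product)
    then have \<mu>: "?\<mu> s = Suc (n * n - card G)"
      using that(2) storesD(3)[OF G(2)] by (simp add: Suc_diff_le)
    have ext: "extends {..<n} k G (u, v) \<longleftrightarrow> u < n \<and> v < n \<and> admissible k G (u, v)" for u v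
    proof (cases "u < n \<and> v < n")
      case True
      then show ?thesis
        using extends_iff[OF _ feas, of u v] by (simp add: admissible_def)
    next
      case False
      then show ?thesis
        by (auto simp: extends_def feasible_iff)
    qed
    have "runs (Cond (NLess (NConst 0) (var ''go'')) add_arc Skip) (1 + max (8 + n * 4) 1)
        (\<lambda>s'. ?I s' \<and> ?\<mu> s' < ?\<mu> s) s1"
      if s1: "scanned n k f G ({..<n} \<times> {..<n}) s1" for s1
    proof (rule runs_Cond)
      assume "tval (NLess (NConst 0) (var ''go'')) s1"
      then have go: "nats s1 ''go'' 0 \<noteq> 0"
        by simp
      define a b where "a = nats s1 ''bu'' 0" and "b = nats s1 ''bv'' 0"
      have ab: "a < n" "b < n" "admissible k G (a, b)" "reals s1 ''best'' 0 = f b {a}" "0 < f b {a}"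
        using s1 go by (auto simp: scanned_def a_def b_def Let_def)
      have new: "(a, b) \<notin> G"
        using ab(3) joined_arc[of a b G] by (auto simp: admissible_def)
      have "f v {u} \<le> f b {a}" if "extends {..<n} k G (u, v)" for u v
        using s1 that ab(4) by (auto simp: scanned_def ext)
      then have "greedy {..<n} k f (insert (a, b) G)"
        using G(1) ab by (intro greedy_insert) (auto simp: ext)
      moreover have "card (insert (a, b) G) = Suc (card G)"
        using fin new by simp
      moreover have "card (insert (a, b) G) \<le> n * n"
        using card_mono[of "{..<n} \<times> {..<n}" "insert (a, b) G"] sub ab
        by (simp add: card_cartesian_product)
      ultimately show "runs add_arc (8 + n * 4) (\<lambda>s'. ?I s' \<and> ?\<mu> s' < ?\<mu> s) s1"
        using s1 fin ab(1,2) new go \<mu>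
        by (intro runs_conseq[OF add_arc_correct[of n k f G s1 a b]])
          (auto simp: scanned_def a_def b_def dest: storesD(3))
    next
      assume "\<not> tval (NLess (NConst 0) (var ''go'')) s1"
      then have "nats s1 ''go'' 0 = 0"
        by simp
      \<comment> \<open>With \<open>go\<close> at 0, \<open>best\<close> is 0 and bounds the score
        of every admissible arc.\<close>
      moreover have "?stop G"
        using s1 calculation by (fastforce simp: scanned_def ext)
      ultimately show "runs Skip 1 (\<lambda>s'. ?I s' \<and> ?\<mu> s' < ?\<mu> s) s1"
        using s1 G(1) \<mu> by (intro runs_Skip) (auto simp: scanned_def)
    qed
    then show ?thesis
      by (intro runs_Seq runs_conseq[OF scan_correct[OF G(2,3)]]) auto
  qed
  have loop: "runs (While (NLess (NConst 0) (var ''go'')) ?body) (1 + Suc (n * n) * (1 + ?T))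
      (\<lambda>s'. greedy {..<n} k f (output_arcs s') \<and> ?stop (output_arcs s')) s"
    if "?I s" for s
  proof (rule runs_conseq[OF runs_While[where I = ?I and \<mu> = ?\<mu>, OF body that]])
    show "1 + ?\<mu> s * (1 + ?T) \<le> 1 + Suc (n * n) * (1 + ?T)"
      by (intro add_left_mono mult_le_mono1) simp
  qed (auto dest: storesD(4))
  have "runs greedy_prog ((1 + n * 3) + (1 + (1 + Suc (n * n) * (1 + ?T))))
      (\<lambda>s'. greedy {..<n} k f (output_arcs s') \<and> ?stop (output_arcs s')) (input_state n k f)"
    unfolding greedy_prog_def
  proof (rule runs_Seq, rule runs_conseq[OF init_labels_correct[of n k f]])
    fix s assume s: "stores n k f {} s \<and> labels n {} (nats s ''comp'')"
    show "runs (Seq (assign ''go'' (NConst 1)) (While (NLess (NConst 0) (var ''go'')) ?body))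
        (1 + (1 + Suc (n * n) * (1 + ?T)))
        (\<lambda>s'. greedy {..<n} k f (output_arcs s') \<and> ?stop (output_arcs s')) s"
      by (rule runs_Seq, rule runs_NSet, rule loop, rule exI[of _ "{}"])
        (use s in \<open>simp add: greedy_empty\<close>)
  qed simp
  then show ?thesis
    by (rule runs_conseq) (auto simp: algebra_simps)
qed

theorem theorem4p2:
  shows "\<exists>(prog :: com) (p :: nat poly).
    \<forall>(n :: nat) (k :: nat) (f :: nat \<Rightarrow> nat set \<Rightarrow> real).
      additive_scores {..<n} f \<longrightarrow>
      (\<exists>t s. exec prog (input_state n k f) t s \<and> t \<le> poly p n \<and>
         feasible {..<n} k (output_arcs s) \<and>
         (\<forall>D_opt. optimal {..<n} k f D_opt \<longrightarrow>
            score {..<n} f (output_arcs s) \<le> score {..<n} f D_opt \<and>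
            score {..<n} f D_opt \<le> 2 * score {..<n} f (output_arcs s)))"
proof -
  \<comment> \<open>Coefficients in ascending order: \<open>3 + 3 * n\<close> for the labelling, the
    first setting of \<open>go\<close> and the final test, then at most \<open>1 + n * n\<close>
    rounds of at most \<open>15 + 8 * n + 8 * n * n\<close> steps, loop test included.\<close>
  let ?p = "[:3, 3:] + [:1, 0, 1:] * [:15, 8, 8:] :: nat poly"
  show ?thesis
  proof (rule exI[of _ greedy_prog], rule exI[of _ ?p], intro allI impI)
    fix n k :: nat and f :: "nat \<Rightarrow> nat set \<Rightarrow> real"
    assume additive: "additive_scores {..<n} f"
    obtain t s where run: "exec greedy_prog (input_state n k f) t s"
        "t \<le> 3 + n * 3 + (1 + n * n) * (15 + n * 8 + n * n * 8)"
      and greedy: "greedy {..<n} k f (output_arcs s)"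
      and stop: "\<And>u v. extends {..<n} k (output_arcs s) (u, v) \<Longrightarrow> f v {u} \<le> 0"
      using greedy_prog_correct[of n k f] by (auto simp: runs_def)
    have feasible: "feasible {..<n} k (output_arcs s)"
      using greedy by (rule greedy_feasible)
    have "poly ?p n = 3 + n * 3 + (1 + n * n) * (15 + n * 8 + n * n * 8)"
      by (simp add: algebra_simps)
    then have "t \<le> poly ?p n"
      using run(2) by presburger
    moreover have "score {..<n} f (output_arcs s) \<le> score {..<n} f D \<and>
        score {..<n} f D \<le> 2 * score {..<n} f (output_arcs s)" if "optimal {..<n} k f D" for D
      using that feasible greedy_two_approximation[OF _ additive greedy _ stop]
      by (auto simp: optimal_def)
    ultimately show "\<exists>t s. exec greedy_prog (input_state n k f) t s \<and> t \<le> poly ?p n \<and>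
        feasible {..<n} k (output_arcs s) \<and>
        (\<forall>D_opt. optimal {..<n} k f D_opt \<longrightarrow>
          score {..<n} f (output_arcs s) \<le> score {..<n} f D_opt \<and>
          score {..<n} f D_opt \<le> 2 * score {..<n} f (output_arcs s))"
      using run(1) feasible by blast
  qed
qed

end
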